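(* Let $(X=\{x_1,\ldots,x_n\},d)$ with $n\ge 2$ be a finite quasihypermetric space. Consider the linear system $Dw=\mathbf{1}$, where $D$ is the distance matrix $\bigl(d(x_i,x_j)\bigr)_{i,j=1}^n$ and $\mathbf{1}$ is the vector $(1,\ldots,1)^T$ of length $n$. Then a solution $w=(w_1,\ldots,w_n)^T\in\mathbb{R}^n$ to the system exists. Further, for any solution $w$: (1) if $\sum_{i=1}^n w_i=0$, then $M(X)=\infty$; and (2) if $\sum_{i=1}^n w_i=w_0\neq 0$, then $M(X)=1/w_0<\infty$, and $(1/w_0)\sum_{i=1}^n w_i\delta_{x_i}\in\mathcal{M}_1(X)$ is a maximal measure on $X$.
   Context: The points $x_1,\dots,x_n$ are distinct. $(X,d)$ is quasihypermetric if $\sum_{i,j=1}^k\alpha_i\alpha_jd(z_i,z_j)\le 0$ for all $k\in\mathbb{N}$, all $z_1,\dots,z_k\in X$ and all real $\alpha_1,\dots,\alpha_k$ with $\sum_i\alpha_i=0$. $\mathcal{M}_1(X)$ is the set of finite signed Borel measures on $X$ of total mass $1$; $I(\mu)=\int_X\int_X d(x,y)\,d\mu(x)\,d\mu(y)$; $M(X)=\sup\{I(\mu):\mu\in\mathcal{M}_1(X)\}\in[0,\infty]$. A maximal measure on $X$ is a $\mu\in\mathcal{M}_1(X)$ with $I(\mu)=M(X)$. $\delta_x$ is the unit atomic measure at $x$. *)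

theory Defs
  imports "HOL-Probability.Probability"
begin

definition quasihypermetric :: "'a set \<Rightarrow> ('a \<Rightarrow> 'a \<Rightarrow> real) \<Rightarrow> bool" where
  "quasihypermetric X d \<longleftrightarrow> Metric_space X d \<and>
    (\<forall>(k::nat) (z :: nat \<Rightarrow> 'a) (\<alpha> :: nat \<Rightarrow> real).
       (\<forall>i\<in>{1..k}. z i \<in> X) \<longrightarrow> (\<Sum>i=1..k. \<alpha> i) = 0 \<longrightarrow>
       (\<Sum>i=1..k. \<Sum>j=1..k. \<alpha> i * \<alpha> j * d (z i) (z j)) \<le> 0)"

definition metric_borel :: "'a set \<Rightarrow> ('a \<Rightarrow> 'a \<Rightarrow> real) \<Rightarrow> 'a measure" where
  "metric_borel X d = sigma X {U. openin (Metric_space.mtopology X d) U}"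

text \<open>A finite signed measure is a real-valued countably additive set function. Only the
  \<open>\<sigma>\<close>-algebra of \<open>M\<close> matters. As for \<^const>\<open>measure\<close>, the value
  off the \<open>\<sigma>\<close>-algebra is fixed to be \<open>0\<close>.\<close>

definition finite_signed_measure :: "'a measure \<Rightarrow> ('a set \<Rightarrow> real) \<Rightarrow> bool" where
  "finite_signed_measure M \<mu> \<longleftrightarrow>
     \<mu> {} = 0 \<and>
     (\<forall>A. A \<notin> sets M \<longrightarrow> \<mu> A = 0) \<and>
     (\<forall>A :: nat \<Rightarrow> 'a set. range A \<subseteq> sets M \<longrightarrow> disjoint_family A \<longrightarrow>
        (\<lambda>i. \<mu> (A i)) sums \<mu> (\<Union>i. A i))"

text \<open>The upper variation, i.e. the positive part of the Jordan decomposition. The supremum is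
  nonnegative because of \<open>B = {}\<close>, so truncating \<open>\<mu> B\<close> at \<open>0\<close> by
  \<^const>\<open>ennreal\<close> is harmless. The negative part is the upper variation of \<open>-\<mu>\<close>.\<close>

definition upper_variation :: "'a measure \<Rightarrow> ('a set \<Rightarrow> real) \<Rightarrow> 'a measure" where
  "upper_variation M \<mu> =
     measure_of (space M) (sets M) (\<lambda>A. SUP B\<in>{B \<in> sets M. B \<subseteq> A}. ennreal (\<mu> B))"

definition signed_integral :: "'a measure \<Rightarrow> ('a set \<Rightarrow> real) \<Rightarrow> ('a \<Rightarrow> real) \<Rightarrow> real" where
  "signed_integral M \<mu> f =
     integral\<^sup>L (upper_variation M \<mu>) f - integral\<^sup>L (upper_variation M (\<lambda>A. - \<mu> A)) f"

definition unit_mass_measures :: "'a set \<Rightarrow> ('a \<Rightarrow> 'a \<Rightarrow> real) \<Rightarrow> ('a set \<Rightarrow> real) set" where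
  "unit_mass_measures X d = {\<mu>. finite_signed_measure (metric_borel X d) \<mu> \<and> \<mu> X = 1}"

definition energy :: "'a set \<Rightarrow> ('a \<Rightarrow> 'a \<Rightarrow> real) \<Rightarrow> ('a set \<Rightarrow> real) \<Rightarrow> real" where
  "energy X d \<mu> =
     signed_integral (metric_borel X d) \<mu>
       (\<lambda>y. signed_integral (metric_borel X d) \<mu> (\<lambda>x. d x y))"

definition max_energy :: "'a set \<Rightarrow> ('a \<Rightarrow> 'a \<Rightarrow> real) \<Rightarrow> ereal" where
  "max_energy X d = (SUP \<mu>\<in>unit_mass_measures X d. ereal (energy X d \<mu>))"

definition maximal_measure :: "'a set \<Rightarrow> ('a \<Rightarrow> 'a \<Rightarrow> real) \<Rightarrow> ('a set \<Rightarrow> real) \<Rightarrow> bool" where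
  "maximal_measure X d \<mu> \<longleftrightarrow>
     \<mu> \<in> unit_mass_measures X d \<and> ereal (energy X d \<mu>) = max_energy X d"

definition unit_atom :: "'a set \<Rightarrow> ('a \<Rightarrow> 'a \<Rightarrow> real) \<Rightarrow> 'a \<Rightarrow> 'a set \<Rightarrow> real" where
  "unit_atom X d x = measure (return (metric_borel X d) x)"

definition distance_matrix :: "('a \<Rightarrow> 'a \<Rightarrow> real) \<Rightarrow> ('n::finite \<Rightarrow> 'a) \<Rightarrow> real ^ 'n ^ 'n" where
  "distance_matrix d x = (\<chi> i j. d (x i) (x j))"

end

theory Submission imports Defs begin

text \<open>On a finite space a signed measure is the vector of its point masses, and its energy is the
  quadratic form \<open>q u = u \<bullet> (D *v u)\<close>, which is nonpositive on vectors of sum \<open>0\<close>.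
  If \<open>D *v v = 0\<close> with \<open>v\<close> of sum \<open>1\<close>, then \<open>e\<^sub>i + e\<^sub>j - 2 v\<close> has sum \<open>0\<close> and
  \<open>q (e\<^sub>i + e\<^sub>j - 2 v) = q (e\<^sub>i + e\<^sub>j) = 2 d (x i) (x j) > 0\<close>, which is impossible. So the kernel of
  the symmetric matrix \<open>D\<close> is orthogonal to the all-ones vector, which therefore lies in its range.
  If a solution \<open>w\<close> has sum \<open>0\<close>, then \<open>q (e\<^sub>i + t w) = 2 t\<close> is unbounded; if it has sum
  \<open>w\<^sub>0 \<noteq> 0\<close>, then for \<open>v = w / w\<^sub>0\<close> and \<open>u\<close> of sum \<open>0\<close>
  the cross term vanishes: \<open>q (u + v) = q u + 1 / w\<^sub>0 \<le> 1 / w\<^sub>0\<close>.\<close>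

section \<open>Signed measures and integrals on a finite metric space\<close>

lemma sets_metric_borel_finite:
  assumes "Metric_space X d" and "finite X"
  shows "sets (metric_borel X d) = Pow X" and "space (metric_borel X d) = X"
proof -
  interpret Metric_space X d by fact
  have "mtopology = discrete_topology X"
    using finite_t1_space_imp_discrete_topology[of mtopology X] assms(2) t1_space_mtopology
    by simp
  hence "metric_borel X d = sigma X (Pow X)"
    by (simp add: metric_borel_def Pow_def)
  thus "sets (metric_borel X d) = Pow X" "space (metric_borel X d) = X"
    by (simp_all add: sigma_algebra.sigma_sets_eq sigma_algebra_Pow)
qed

lemma finite_signed_measure_finite_sum:
  assumes \<mu>: "finite_signed_measure M \<mu>" and M: "sets M = Pow X" and "finite X" and "A \<subseteq> X"
  shows "\<mu> A = (\<Sum>a\<in>A. \<mu> {a})"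
proof -
  have "finite A" using assms finite_subset by blast
  from this \<open>A \<subseteq> X\<close> show ?thesis
  proof (induction A rule: finite_induct)
    case empty
    thus ?case using \<mu> by (simp add: finite_signed_measure_def)
  next
    case (insert a A)
    \<comment> \<open>The sequence \<open>{a}, A, {}, {}, ...\<close> reduces additivity for two
      disjoint sets to countable additivity.\<close>
    let ?F = "binaryset {a} A"
    have "range ?F \<subseteq> sets M" "disjoint_family ?F"
      using insert.prems insert.hyps M
      by (auto simp: binaryset_def disjoint_family_on_def split: if_splits)
    hence "(\<lambda>i. \<mu> (?F i)) sums \<mu> (\<Union>i. ?F i)"
      using \<mu> by (auto simp: finite_signed_measure_def)
    moreover have "(\<lambda>i. \<mu> (?F i)) sums (\<mu> {a} + \<mu> A)"
      using \<mu> by (intro binaryset_sums) (simp add: finite_signed_measure_def)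
    ultimately have "\<mu> (insert a A) = \<mu> {a} + \<mu> A"
      using sums_unique2 by (fastforce simp: UN_binaryset_eq)
    thus ?case using insert by simp
  qed
qed

text \<open>The supremum over subsets of \<open>A\<close> is attained at the set of points of
  \<open>A\<close> with positive mass. Only additivity over points is assumed of \<mu>, so the lemma
  applies to \<mu> and to its negative alike.\<close>

lemma upper_variation_finite:
  assumes M: "sets M = Pow X" "space M = X" and "finite X"
    and additive: "\<And>A. A \<subseteq> X \<Longrightarrow> \<mu> A = (\<Sum>a\<in>A. \<mu> {a})"
  shows "upper_variation M \<mu> = point_measure X (\<lambda>a. ennreal (max 0 (\<mu> {a})))"
proof -
  let ?P = "point_measure X (\<lambda>a. ennreal (max 0 (\<mu> {a})))"
  have "(SUP B\<in>{B \<in> Pow X. B \<subseteq> A}. ennreal (\<mu> B)) = emeasure ?P A" if A: "A \<subseteq> X" for A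
  proof -
    have fA: "finite A" using A \<open>finite X\<close> finite_subset by blast
    have "emeasure ?P A = (\<Sum>a\<in>A. ennreal (max 0 (\<mu> {a})))"
      by (rule emeasure_point_measure_finite[OF \<open>finite X\<close> A])
    also have "\<dots> = ennreal (\<Sum>a\<in>A. max 0 (\<mu> {a}))" by (rule sum_ennreal) simp
    also have "\<dots> = (SUP B\<in>{B \<in> Pow X. B \<subseteq> A}. ennreal (\<mu> B))"
    proof (rule antisym)
      have "(\<Sum>a\<in>A. max 0 (\<mu> {a})) = (\<Sum>a\<in>{a\<in>A. \<mu> {a} > 0}. \<mu> {a})"
        using fA by (simp add: sum.inter_filter max_def if_distrib)
          (intro sum.cong, auto)
      also have "\<dots> = \<mu> {a\<in>A. \<mu> {a} > 0}"
        using A by (intro additive[symmetric]) auto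
      finally show "ennreal (\<Sum>a\<in>A. max 0 (\<mu> {a})) \<le> (SUP B\<in>{B \<in> Pow X. B \<subseteq> A}. ennreal (\<mu> B))"
        using A by (auto intro!: SUP_upper2[where i = "{a\<in>A. \<mu> {a} > 0}"])
      show "(SUP B\<in>{B \<in> Pow X. B \<subseteq> A}. ennreal (\<mu> B)) \<le> ennreal (\<Sum>a\<in>A. max 0 (\<mu> {a}))"
      proof (rule SUP_least, rule ennreal_leI)
        fix B assume B: "B \<in> {B \<in> Pow X. B \<subseteq> A}"
        hence "\<mu> B = (\<Sum>a\<in>B. \<mu> {a})" using additive by blast
        also have "\<dots> \<le> (\<Sum>a\<in>B. max 0 (\<mu> {a}))" by (intro sum_mono) auto
        also have "\<dots> \<le> (\<Sum>a\<in>A. max 0 (\<mu> {a}))" using B fA by (intro sum_mono2) auto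
        finally show "\<mu> B \<le> (\<Sum>a\<in>A. max 0 (\<mu> {a}))" .
      qed
    qed
    finally show ?thesis by simp
  qed
  \<comment> \<open>\<open>measure_of\<close> depends only on the values on the sigma-algebra, and
    these agree with those of a genuine measure; so the supremum need not be shown countably
    additive by hand.\<close>
  hence "upper_variation M \<mu> = measure_of X (Pow X) (emeasure ?P)"
    unfolding upper_variation_def M
    by (intro measure_of_eq) (auto simp: sigma_algebra.sigma_sets_eq sigma_algebra_Pow)
  also have "\<dots> = ?P"
    using measure_of_of_measure[of ?P] by (simp add: space_point_measure sets_point_measure)
  finally show ?thesis .
qed

text \<open>Both Jordan parts are point measures, so the integrals are finite sums, and
  \<open>max 0 r - max 0 (- r) = r\<close> recombines them.\<close>

lemma signed_integral_finite:
  assumes M: "sets M = Pow X" "space M = X" and "finite X" and \<mu>: "finite_signed_measure M \<mu>"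
  shows "signed_integral M \<mu> f = (\<Sum>a\<in>X. \<mu> {a} * f a)"
proof -
  have additive: "\<mu> A = (\<Sum>a\<in>A. \<mu> {a})" if "A \<subseteq> X" for A
    using finite_signed_measure_finite_sum[OF \<mu> M(1) \<open>finite X\<close> that] .
  hence neg: "- \<mu> A = (\<Sum>a\<in>A. - \<mu> {a})" if "A \<subseteq> X" for A
    using that by (simp add: sum_negf)
  have pos_part: "upper_variation M \<mu> = point_measure X (\<lambda>a. ennreal (max 0 (\<mu> {a})))"
    using M \<open>finite X\<close> additive by (rule upper_variation_finite)
  have neg_part: "upper_variation M (\<lambda>A. - \<mu> A) =
      point_measure X (\<lambda>a. ennreal (max 0 (- \<mu> {a})))"
    using M \<open>finite X\<close> neg by (rule upper_variation_finite)
  have "signed_integral M \<mu> f =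
      (\<Sum>a\<in>X. max 0 (\<mu> {a}) * f a) - (\<Sum>a\<in>X. max 0 (- \<mu> {a}) * f a)"
    unfolding signed_integral_def pos_part neg_part
    using \<open>finite X\<close> by (subst (1 2) lebesgue_integral_point_measure_finite) simp_all
  also have "\<dots> = (\<Sum>a\<in>X. \<mu> {a} * f a)"
    unfolding sum_subtractf[symmetric] by (intro sum.cong) (auto simp: max_def)
  finally show ?thesis .
qed

lemma energy_finite:
  assumes "Metric_space X d" and "finite X" and "finite_signed_measure (metric_borel X d) \<mu>"
  shows "energy X d \<mu> = (\<Sum>b\<in>X. \<mu> {b} * (\<Sum>a\<in>X. \<mu> {a} * d a b))"
  unfolding energy_def
  by (simp add: signed_integral_finite[OF sets_metric_borel_finite[OF assms(1,2)] assms(2,3)])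

lemma finite_signed_measure_return_combination:
  fixes x :: "'i \<Rightarrow> 'a"
  assumes x: "\<And>i. i \<in> I \<Longrightarrow> x i \<in> space M"
  shows "finite_signed_measure M (\<lambda>A. \<Sum>i\<in>I. v i * measure (return M (x i)) A)"
  unfolding finite_signed_measure_def
proof (intro conjI allI impI)
  fix A :: "nat \<Rightarrow> 'a set"
  assume A: "range A \<subseteq> sets M" "disjoint_family A"
  have "(\<lambda>k. measure (return M (x i)) (A k)) sums measure (return M (x i)) (\<Union>k. A k)" if "i \<in> I" for i
  proof -
    interpret prob_space "return M (x i)" using x[OF that] by (rule prob_space_return)
    show ?thesis using A by (intro finite_measure_UNION) auto
  qed
  thus "(\<lambda>k. \<Sum>i\<in>I. v i * measure (return M (x i)) (A k)) sums
        (\<Sum>i\<in>I. v i * measure (return M (x i)) (\<Union>k. A k))"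
    by (intro sums_sum sums_mult)
\<comment> \<open>Off the sigma-algebra \<open>measure\<close> is 0, as
  \<open>finite_signed_measure\<close> demands.\<close>
qed (auto simp: measure_notin_sets)

section \<open>Symmetric matrices and their quadratic forms\<close>

lemma inner_mult_vec_commute:
  fixes A :: "real ^ 'n ^ 'n"
  assumes "transpose A = A"
  shows "u \<bullet> (A *v v) = v \<bullet> (A *v u)"
  by (metis assms dot_lmul_matrix inner_commute transpose_matrix_vector)

text \<open>The component \<open>z\<close> of \<open>b\<close> orthogonal to the range of
  \<open>A\<close> lies in the kernel of \<open>A\<close> by symmetry, hence is orthogonal to
  \<open>b\<close> and so to itself.\<close>

lemma symmetric_matrix_solvable:
  fixes A :: "real ^ 'n ^ 'n"
  assumes sym: "transpose A = A" and ker: "\<And>v. A *v v = 0 \<Longrightarrow> v \<bullet> b = 0"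
  shows "\<exists>w. A *v w = b"
proof -
  have sub: "subspace (range ((*v) A))"
    by (intro linear_subspace_image) auto
  obtain y z where y: "y \<in> span (range ((*v) A))"
    and z: "\<And>w. w \<in> span (range ((*v) A)) \<Longrightarrow> orthogonal z w" and b: "b = y + z"
    using orthogonal_subspace_decomp_exists[of "range ((*v) A)" b] by metis
  have "(A *v z) \<bullet> (A *v z) = z \<bullet> (A *v (A *v z))"
    using inner_mult_vec_commute[OF sym, of "A *v z" z] by simp
  also have "\<dots> = 0" using z[of "A *v (A *v z)"] by (simp add: orthogonal_def span_base)
  finally have "z \<bullet> b = 0" using ker by simp
  moreover have "z \<bullet> y = 0" using z[OF y] by (simp add: orthogonal_def)
  ultimately have "z = 0" using b by (simp add: inner_add_right)
  thus ?thesis using y b sub by (metis add.right_neutral imageE span_eq_iff)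
qed

lemma quadratic_form_add:
  fixes A :: "real ^ 'n ^ 'n"
  assumes "transpose A = A"
  shows "(u + v) \<bullet> (A *v (u + v)) = u \<bullet> (A *v u) + 2 * (u \<bullet> (A *v v)) + v \<bullet> (A *v v)"
  using inner_mult_vec_commute[OF assms, of v u]
  by (simp add: matrix_vector_right_distrib inner_add_left inner_add_right)

lemma inner_ones: "v \<bullet> (\<chi> i. 1) = (\<Sum>i\<in>UNIV. v $ i)" for v :: "real ^ 'n"
  by (simp add: inner_vec_def)

lemma inner_distance_matrix:
  "u \<bullet> (distance_matrix d x *v u) = (\<Sum>i\<in>UNIV. \<Sum>j\<in>UNIV. u $ i * u $ j * d (x i) (x j))"
  by (simp add: inner_vec_def matrix_vector_mult_def distance_matrix_def sum_distrib_left mult_ac)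

section \<open>The distance matrix of a finite quasihypermetric space\<close>

locale finite_quasihypermetric =
  fixes X :: "'a set" and d :: "'a \<Rightarrow> 'a \<Rightarrow> real" and x :: "'n::finite \<Rightarrow> 'a"
  assumes card: "CARD('n) \<ge> 2" and inj: "inj x" and X: "X = range x"
    and qhm: "quasihypermetric X d"
begin

abbreviation "D \<equiv> distance_matrix d x"

abbreviation combination :: "real ^ 'n \<Rightarrow> 'a set \<Rightarrow> real" where
  "combination v \<equiv> (\<lambda>A. \<Sum>i\<in>UNIV. v $ i * unit_atom X d (x i) A)"

sublocale Metric_space X d
  using qhm by (simp add: quasihypermetric_def)

lemma finite_X: "finite X" by (simp add: X)

lemma x_in_X [simp]: "x i \<in> X" by (simp add: X)

lemma transpose_D: "transpose D = D"
  by (simp add: transpose_def distance_matrix_def vec_eq_iff commute)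

lemma quadratic_form_nonpos:
  assumes "(\<Sum>i\<in>UNIV. u $ i) = 0"
  shows "u \<bullet> (D *v u) \<le> 0"
proof -
  \<comment> \<open>\<open>quasihypermetric\<close> numbers its points by \<open>{1..k}\<close>,
    while vectors are indexed by the type \<open>'n\<close>; the bijection translates between the
    two.\<close>
  obtain h where h: "bij_betw h {1..CARD('n)} (UNIV :: 'n set)"
    using ex_bij_betw_nat_finite_1[of "UNIV :: 'n set"] by auto
  have reindex: "(\<Sum>i=1..CARD('n). g (h i)) = (\<Sum>i\<in>UNIV. g i)" for g :: "'n \<Rightarrow> real"
    by (rule sum.reindex_bij_betw[OF h])
  have "(\<Sum>i=1..CARD('n). u $ h i) = 0" using assms reindex[of "\<lambda>i. u $ i"] by simp
  hence "(\<Sum>i=1..CARD('n). \<Sum>j=1..CARD('n). u $ h i * u $ h j * d (x (h i)) (x (h j))) \<le> 0"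
    using qhm X unfolding quasihypermetric_def
    by (elim conjE allE[of _ "CARD('n)"] allE[of _ "\<lambda>i. x (h i)"] allE[of _ "\<lambda>i. u $ h i"]) auto
  also have "(\<Sum>i=1..CARD('n). \<Sum>j=1..CARD('n). u $ h i * u $ h j * d (x (h i)) (x (h j))) =
      (\<Sum>i=1..CARD('n). \<Sum>j\<in>UNIV. u $ h i * u $ j * d (x (h i)) (x j))"
    by (intro sum.cong refl reindex[of "\<lambda>j. u $ h _ * u $ j * d (x (h _)) (x j)"])
  also have "\<dots> = u \<bullet> (D *v u)"
    unfolding inner_distance_matrix by (rule reindex)
  finally show ?thesis .
qed

lemma quadratic_form_axis: "axis i 1 \<bullet> (D *v axis j 1) = d (x i) (x j)"
  by (simp add: inner_axis' matrix_vector_mult_basis column_def distance_matrix_def)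

lemma kernel_sum_zero:
  assumes "D *v v = 0"
  shows "(\<Sum>i\<in>UNIV. v $ i) = 0"
proof (rule ccontr)
  define s where "s = (\<Sum>i\<in>UNIV. v $ i)"
  assume "(\<Sum>i\<in>UNIV. v $ i) \<noteq> 0"
  hence s: "s \<noteq> 0" by (simp add: s_def)
  obtain i j :: 'n where "i \<noteq> j"
    using card by (metis UNIV_I card_2_iff' card_le_Suc0_iff_eq finite not_less_eq_eq numeral_2_eq_2)
  define e where "e = axis i 1 + (axis j 1 :: real ^ 'n)"
  \<comment> \<open>Chosen so that \<open>c *\<^sub>R v\<close> has sum -2, cancelling the sum 2 of
    \<open>e\<close>.\<close>
  define c where "c = - 2 / s"
  define u where "u = e + c *\<^sub>R v"
  have sum_e: "e \<bullet> (\<chi> i. 1) = 2"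
    by (simp add: e_def inner_add_left inner_axis')
  have "u \<bullet> (\<chi> i. 1) = 0"
    using s by (simp add: u_def c_def inner_diff_left sum_e inner_ones[of v] flip: s_def)
  hence "u \<bullet> (D *v u) \<le> 0"
    by (intro quadratic_form_nonpos) (simp add: inner_ones)
  \<comment> \<open>Both terms containing \<open>v\<close> vanish because \<open>v\<close> is in the
    kernel.\<close>
  moreover have "u \<bullet> (D *v u) = e \<bullet> (D *v e)"
    using assms by (simp add: u_def quadratic_form_add[OF transpose_D] matrix_vector_mult_scaleR)
  \<comment> \<open>The diagonal of \<open>D\<close> is zero, so only the cross term
    survives.\<close>
  moreover have "e \<bullet> (D *v e) = 2 * d (x i) (x j)"
    by (simp add: e_def quadratic_form_add[OF transpose_D] quadratic_form_axis)
  moreover have "d (x i) (x j) > 0"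
    using \<open>i \<noteq> j\<close> inj by (simp add: inj_eq)
  ultimately show False by simp
qed

section \<open>Measures as vectors of point masses\<close>

lemma energy_eq:
  assumes "finite_signed_measure (metric_borel X d) \<mu>"
  shows "energy X d \<mu> = (\<chi> i. \<mu> {x i}) \<bullet> (D *v (\<chi> i. \<mu> {x i}))"
proof -
  have reindex: "(\<Sum>a\<in>X. g a) = (\<Sum>i\<in>UNIV. g (x i))" for g :: "'a \<Rightarrow> real"
    using inj by (simp add: X sum.reindex)
  show ?thesis
    unfolding energy_finite[OF Metric_space_axioms finite_X assms] reindex inner_distance_matrix
    by (simp add: sum_distrib_left mult_ac commute)
qed

lemma unit_mass_sum:
  assumes "\<mu> \<in> unit_mass_measures X d"
  shows "(\<Sum>i\<in>UNIV. \<mu> {x i}) = 1"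
proof -
  have "\<mu> X = (\<Sum>a\<in>X. \<mu> {a})"
    using assms sets_metric_borel_finite[OF Metric_space_axioms finite_X]
    by (intro finite_signed_measure_finite_sum[of "metric_borel X d" \<mu> X])
      (auto simp: unit_mass_measures_def finite_X)
  thus ?thesis using assms inj by (simp add: unit_mass_measures_def X sum.reindex)
qed

lemma unit_atom_eq: "A \<subseteq> X \<Longrightarrow> unit_atom X d (x i) A = indicator A (x i)"
  unfolding unit_atom_def
  using sets_metric_borel_finite[OF Metric_space_axioms finite_X]
  by (simp add: measure_return)

text \<open>Injectivity of \<open>x\<close> keeps the atoms apart, so the point masses of
  \<open>combination v\<close> give back \<open>v\<close>.\<close>

lemma combination_singleton: "combination v {x j} = v $ j"
  using inj by (simp add: unit_atom_eq indicator_def inj_eq)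

lemma combination_unit_mass:
  assumes "(\<Sum>i\<in>UNIV. v $ i) = 1"
  shows "combination v \<in> unit_mass_measures X d"
proof -
  have "finite_signed_measure (metric_borel X d) (combination v)"
    unfolding unit_atom_def
    using sets_metric_borel_finite[OF Metric_space_axioms finite_X]
    by (intro finite_signed_measure_return_combination) auto
  thus ?thesis using assms by (simp add: unit_mass_measures_def unit_atom_eq)
qed

lemma energy_combination:
  assumes "(\<Sum>i\<in>UNIV. v $ i) = 1"
  shows "energy X d (combination v) = v \<bullet> (D *v v)"
  using combination_unit_mass[OF assms] energy_eq[of "combination v"]
  by (simp add: unit_mass_measures_def combination_singleton)

section \<open>Solvability of the system and the maximal energy\<close>

lemma solution_exists: "\<exists>w. D *v w = (\<chi> i. 1)"
  using kernel_sum_zero by (intro symmetric_matrix_solvable transpose_D) (simp add: inner_ones)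

lemma max_energy_infinite:
  assumes w: "D *v w = (\<chi> i. 1)" and sum0: "(\<Sum>i\<in>UNIV. w $ i) = 0"
  shows "max_energy X d = \<infinity>"
  unfolding max_energy_def
proof (rule SUP_PInfty)
  fix n :: nat
  \<comment> \<open>Any index serves here; \<open>undefined\<close> merely names one.\<close>
  define e :: "real ^ 'n" where "e = axis undefined 1"
  define v where "v = e + real n *\<^sub>R w"
  have e: "e \<bullet> (\<chi> i. 1) = 1" by (simp add: e_def inner_axis')
  have w0: "w \<bullet> (\<chi> i. 1) = 0" using sum0 by (simp add: inner_ones)
  have v: "(\<Sum>i\<in>UNIV. v $ i) = 1"
    unfolding inner_ones[symmetric] by (simp add: v_def inner_add_left e w0)
  have "e \<bullet> (D *v e) = 0" by (simp add: e_def quadratic_form_axis)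
  \<comment> \<open>The cross term is \<open>2 * real n\<close> since \<open>e\<close> has sum 1;
    the square term in \<open>w\<close> is a multiple of the sum of \<open>w\<close>, which is
    0.\<close>
  hence "v \<bullet> (D *v v) = 2 * real n"
    by (simp add: v_def quadratic_form_add[OF transpose_D] matrix_vector_mult_scaleR w e w0)
  thus "\<exists>\<mu>\<in>unit_mass_measures X d. ereal (real n) \<le> ereal (energy X d \<mu>)"
    using combination_unit_mass[OF v] energy_combination[OF v] by (intro bexI[of _ "combination v"]) auto
qed

lemma maximal_combination:
  assumes w: "D *v w = (\<chi> i. 1)" and w0: "(\<Sum>i\<in>UNIV. w $ i) = w\<^sub>0" "w\<^sub>0 \<noteq> 0"
  shows "max_energy X d = ereal (1 / w\<^sub>0)"
    and "maximal_measure X d (combination ((1 / w\<^sub>0) *\<^sub>R w))"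
proof -
  define v where "v = (1 / w\<^sub>0) *\<^sub>R w"
  have Dv: "D *v v = (1 / w\<^sub>0) *\<^sub>R (\<chi> i. 1)"
    by (simp add: v_def matrix_vector_mult_scaleR w)
  have v1: "v \<bullet> (\<chi> i. 1) = 1" using w0 by (simp add: v_def inner_ones[of w])
  hence v: "(\<Sum>i\<in>UNIV. v $ i) = 1" by (simp add: inner_ones)
  have energy_v: "energy X d (combination v) = 1 / w\<^sub>0"
    by (simp add: energy_combination[OF v] Dv v1)
  have le: "energy X d \<mu> \<le> 1 / w\<^sub>0" if \<mu>: "\<mu> \<in> unit_mass_measures X d" for \<mu>
  proof -
    \<comment> \<open>Both vectors have sum 1, so \<open>u\<close> has sum 0: it is orthogonal to
      \<open>D *v v\<close>, and its own quadratic form is nonpositive.\<close>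
    define u where "u = (\<chi> i. \<mu> {x i}) - v"
    have u: "u \<bullet> (\<chi> i. 1) = 0"
      using unit_mass_sum[OF \<mu>] by (simp add: u_def inner_diff_left v1) (simp add: inner_ones)
    have "energy X d \<mu> = (u + v) \<bullet> (D *v (u + v))"
      using \<mu> by (simp add: energy_eq unit_mass_measures_def u_def)
    also have "\<dots> = u \<bullet> (D *v u) + 1 / w\<^sub>0"
      by (simp add: quadratic_form_add[OF transpose_D] Dv u v1)
    also have "\<dots> \<le> 1 / w\<^sub>0"
      using quadratic_form_nonpos[of u] u by (simp add: inner_ones)
    finally show ?thesis .
  qed
  show max: "max_energy X d = ereal (1 / w\<^sub>0)"
    unfolding max_energy_def
  proof (rule antisym)
    show "(SUP \<mu>\<in>unit_mass_measures X d. ereal (energy X d \<mu>)) \<le> ereal (1 / w\<^sub>0)"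
      using le by (intro SUP_least) auto
    show "ereal (1 / w\<^sub>0) \<le> (SUP \<mu>\<in>unit_mass_measures X d. ereal (energy X d \<mu>))"
      using combination_unit_mass[OF v] energy_v by (intro SUP_upper2[of "combination v"]) auto
  qed
  show "maximal_measure X d (combination ((1 / w\<^sub>0) *\<^sub>R w))"
    unfolding maximal_measure_def max
    using combination_unit_mass[OF v] energy_v by (simp add: v_def)
qed

end

theorem theorem5p2:
  fixes X :: "'a set" and d :: "'a \<Rightarrow> 'a \<Rightarrow> real" and x :: "'n::finite \<Rightarrow> 'a"
  assumes "CARD('n) \<ge> 2"
    and "inj x" and "X = range x"
    and "quasihypermetric X d"
  shows "(\<exists>w :: real ^ 'n. distance_matrix d x *v w = (\<chi> i. 1)) \<and>
    (\<forall>w :: real ^ 'n. distance_matrix d x *v w = (\<chi> i. 1) \<longrightarrow>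
       ((\<Sum>i\<in>UNIV. w $ i) = 0 \<longrightarrow> max_energy X d = \<infinity>) \<and>
       (\<forall>w\<^sub>0. (\<Sum>i\<in>UNIV. w $ i) = w\<^sub>0 \<and> w\<^sub>0 \<noteq> 0 \<longrightarrow>
          max_energy X d = ereal (1 / w\<^sub>0) \<and> max_energy X d < \<infinity> \<and>
          (\<lambda>A. (1 / w\<^sub>0) * (\<Sum>i\<in>UNIV. w $ i * unit_atom X d (x i) A)) \<in> unit_mass_measures X d \<and>
          maximal_measure X d
            (\<lambda>A. (1 / w\<^sub>0) * (\<Sum>i\<in>UNIV. w $ i * unit_atom X d (x i) A))))"
proof -
  interpret finite_quasihypermetric X d x
    using assms by unfold_locales
  \<comment> \<open>The theorem has the scalar outside the sum, \<open>combination\<close> has it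
    inside the coefficients.\<close>
  have scale: "combination (c *\<^sub>R w) = (\<lambda>A. c * (\<Sum>i\<in>UNIV. w $ i * unit_atom X d (x i) A))"
    for c and w :: "real ^ 'n"
    by (simp add: sum_distrib_left mult.assoc)
  show ?thesis
  proof (intro conjI allI impI; (elim conjE)?)
    show "\<exists>w. D *v w = (\<chi> i. 1)" by (rule solution_exists)
  next
    fix w assume "D *v w = (\<chi> i. 1)" "(\<Sum>i\<in>UNIV. w $ i) = 0"
    thus "max_energy X d = \<infinity>" by (rule max_energy_infinite)
  next
    fix w w\<^sub>0 assume w: "D *v w = (\<chi> i. 1)" "(\<Sum>i\<in>UNIV. w $ i) = w\<^sub>0" "w\<^sub>0 \<noteq> 0"
    show "max_energy X d = ereal (1 / w\<^sub>0)" by (rule maximal_combination(1)[OF w])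
    thus "max_energy X d < \<infinity>" by simp
    show max: "maximal_measure X d
        (\<lambda>A. (1 / w\<^sub>0) * (\<Sum>i\<in>UNIV. w $ i * unit_atom X d (x i) A))"
      using maximal_combination(2)[OF w] unfolding scale .
    thus "(\<lambda>A. (1 / w\<^sub>0) * (\<Sum>i\<in>UNIV. w $ i * unit_atom X d (x i) A)) \<in> unit_mass_measures X d"
      by (simp add: maximal_measure_def)
  qed
qed

end
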